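(* For every $f\in\mathbf{P}$, $$\widetilde{e}^{D_Z}\big(f(W)\big)=f(W+Z).$$
   Context: $(\mathscr{W},\mathscr{B}(\mathscr{W}),\gamma)$ is the Wiener space: $\mathscr{W}$ is the set of continuous paths $w:[0,1]\to\mathbb{R}$ with $w(0)=0$, with the $\sigma$-field generated by the topology of uniform convergence, and $\gamma$ is Wiener measure; $W(t,w)=w(t)$ is the canonical Wiener process. $\mathscr{H}\subset\mathscr{W}$ is the Cameron-Martin space of absolutely continuous $h$ with square-integrable derivative $\dot h$, with inner product $\langle h_1,h_2\rangle=\int_0^1\dot h_1(t)\dot h_2(t)\,dt$. For $h\in\mathscr{H}$, $[h](w):=\int_0^1\dot h(t)\,dw(t)$ (Wiener integral); translations by $\mathscr{H}$-valued (possibly random) elements are understood via $[h](w+Z(w))=[h](w)+\langle h,Z(w)\rangle$. $\mathbf{P}$ is the algebra of polynomial functionals $F(w)=p([h_1](w),\dots,[h_n](w))$, with $n\in\mathbb{N}$, $h_i\in\mathscr{H}$, $p$ a real polynomial in $n$ variables. For $\theta\in\mathscr{H}$, $D_\theta F(w)=\lim_{\varepsilon\to0}\frac1\varepsilon\{F(w+\varepsilon\theta)-F(w)\}$. Standing assumptions on $Z$: $Z:\mathscr{W}\to\mathscr{H}$ is a predictable map, i.e. $\dot Z(t)$, $0\le t\le1$, is a predictable process with $\|Z\|_{\mathscr{H}}^2=\int_0^1\dot Z(s)^2ds<\infty$ a.s., and the process $\mathcal{E}(\int\dot Z\,dW)_t=\exp\{\int_0^t\dot Z(s)\,dW(s)-\frac12\int_0^t\dot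 Z(s)^2ds\}$ is a true martingale. Fix a complete orthonormal system $\{e_i\}_{i\in\mathbb{N}}$ of $\mathscr{H}$ and write $D_i=D_{e_i}$, $Z_i=\langle Z,e_i\rangle$. Define $D_Z^{\otimes n}F:=\sum_{i_1,\dots,i_n}Z_{i_1}\cdots Z_{i_n}D_{i_1}\cdots D_{i_n}F$ for $F\in\mathbf{P}$ ($D_Z^{\otimes0}=1$), and $\widetilde{e}^{D_Z}:=\sum_{n=0}^\infty\frac1{n!}D_Z^{\otimes n}$ (a finite sum on each element of $\mathbf{P}$). *)

theory Defs
  imports "HOL-Probability.Probability"
begin

section \<open>Wiener space\<close>

text \<open>
  A path on [0,1] is a bounded continuous function on the real line that is constant on
  (-\<infinity>,0] and on [1,\<infinity>). The library norm on bounded continuous functions is then the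
  uniform norm over [0,1], and paths are added and scaled with the library operations.
\<close>

type_synonym path = "real \<Rightarrow>\<^sub>C real"

definition wiener_paths :: "path set" where
  "wiener_paths = {w :: path. w 0 = 0 \<and> (\<forall>t. w t = w (max 0 (min 1 t)))}"

definition wiener_measure :: "path measure \<Rightarrow> bool" where
  "wiener_measure \<gamma> \<longleftrightarrow>
     prob_space \<gamma> \<and>
     space \<gamma> = wiener_paths \<and>
     sets \<gamma> = sets (restrict_space borel wiener_paths) \<and>
     (\<forall>s t. 0 \<le> s \<and> s < t \<and> t \<le> 1 \<longrightarrow>
        distributed \<gamma> lborel (\<lambda>w :: path. w t - w s) (normal_density 0 (sqrt (t - s)))) \<and>
     (\<forall>n (t :: nat \<Rightarrow> real). 0 \<le> t 0 \<and> t n \<le> 1 \<and> (\<forall>i<n. t i \<le> t (Suc i)) \<longrightarrow>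
        prob_space.indep_vars \<gamma> (\<lambda>_. borel) (\<lambda>i (w :: path). w (t (Suc i)) - w (t i)) {..<n})"


section \<open>Cameron--Martin space\<close>

definition absolutely_continuous_01 :: "(real \<Rightarrow> real) \<Rightarrow> bool" where
  "absolutely_continuous_01 h \<longleftrightarrow>
     (\<forall>\<epsilon>>0. \<exists>\<delta>>0. \<forall>n (a :: nat \<Rightarrow> real) b.
        (\<forall>i<n. 0 \<le> a i \<and> a i \<le> b i \<and> b i \<le> 1) \<and>
        (\<forall>i<n. \<forall>j<n. i \<noteq> j \<longrightarrow> {a i<..<b i} \<inter> {a j<..<b j} = {}) \<and>
        (\<Sum>i<n. b i - a i) < \<delta>
        \<longrightarrow> (\<Sum>i<n. \<bar>h (b i) - h (a i)\<bar>) < \<epsilon>)"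

text \<open>
  Absolute continuity already implies differentiability almost everywhere and measurability of
  the derivative. These two consequences are listed only so that \<open>deriv h\<close>, which takes
  an arbitrary value at points of non-differentiability, visibly is the derivative.
\<close>

definition cameron_martin :: "path set" where
  "cameron_martin =
     {h \<in> wiener_paths.
        absolutely_continuous_01 h \<and>
        (AE t in lborel. t \<in> {0..1} \<longrightarrow> (h :: real \<Rightarrow> real) differentiable (at t)) \<and>
        set_borel_measurable lborel {0..1} (deriv h) \<and>
        set_integrable lborel {0..1} (\<lambda>t. (deriv h t)\<^sup>2)}"

definition cm_inner :: "path \<Rightarrow> path \<Rightarrow> real" where
  "cm_inner h k = (LINT t:{0..1}|lborel. deriv h t * deriv k t)"

definition complete_orthonormal :: "(nat \<Rightarrow> path) \<Rightarrow> bool" where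
  "complete_orthonormal e \<longleftrightarrow>
     range e \<subseteq> cameron_martin \<and>
     (\<forall>i j. cm_inner (e i) (e j) = (if i = j then 1 else 0)) \<and>
     (\<forall>h\<in>cameron_martin. \<forall>\<epsilon>>0. \<exists>n c.
        (let r = h - (\<Sum>i<n. c i *\<^sub>R e i) in sqrt (cm_inner r r) < \<epsilon>))"


section \<open>Stochastic integrals with respect to the canonical process\<close>

text \<open>
  The step process with values \<open>\<xi> i\<close> on \<open>(\<tau> i, \<tau> (i+1)]\<close> for \<open>i < k\<close>, and its
  integral over \<open>[0,u]\<close> against the canonical process.
\<close>

definition partition_01 :: "nat \<Rightarrow> (nat \<Rightarrow> real) \<Rightarrow> bool" where
  "partition_01 k \<tau> \<longleftrightarrow> 0 \<le> \<tau> 0 \<and> \<tau> k \<le> 1 \<and> (\<forall>i<k. \<tau> i \<le> \<tau> (Suc i))"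

definition step_process ::
  "nat \<Rightarrow> (nat \<Rightarrow> real) \<Rightarrow> (nat \<Rightarrow> path \<Rightarrow> real) \<Rightarrow> real \<Rightarrow> path \<Rightarrow> real" where
  "step_process k \<tau> \<xi> s w = (\<Sum>i<k. \<xi> i w * indicator {\<tau> i<..\<tau> (Suc i)} s)"

definition step_integral ::
  "nat \<Rightarrow> (nat \<Rightarrow> real) \<Rightarrow> (nat \<Rightarrow> path \<Rightarrow> real) \<Rightarrow> real \<Rightarrow> path \<Rightarrow> real" where
  "step_integral k \<tau> \<xi> u w = (\<Sum>i<k. \<xi> i w * (w (min (\<tau> (Suc i)) u) - w (min (\<tau> i) u)))"

text \<open>
  The Wiener integral of \<open>deriv h\<close>: the \<open>L\<^sup>2(\<gamma>)\<close>-limit of the integrals of deterministic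
  step functions (step processes that do not depend on the path, here evaluated at the path 0)
  converging to \<open>deriv h\<close> in \<open>L\<^sup>2[0,1]\<close>. It is determined up to
  \<open>\<gamma>\<close>-null sets; \<open>X\<close> is a version of it.
\<close>

definition wiener_integral :: "path measure \<Rightarrow> path \<Rightarrow> (path \<Rightarrow> real) \<Rightarrow> bool" where
  "wiener_integral \<gamma> h X \<longleftrightarrow>
     X \<in> borel_measurable (completion \<gamma>) \<and>
     (\<exists>k \<tau> (c :: nat \<Rightarrow> nat \<Rightarrow> real).
        (\<forall>m. partition_01 (k m) (\<tau> m)) \<and>
        ((\<lambda>m. \<integral>\<^sup>+t\<in>{0..1}. ennreal ((step_process (k m) (\<tau> m) (\<lambda>i _. c m i) t 0 - deriv h t)\<^sup>2) \<partial>lborel)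
           \<longlonglongrightarrow> 0) \<and>
        ((\<lambda>m. \<integral>\<^sup>+w. ennreal ((step_integral (k m) (\<tau> m) (\<lambda>i _. c m i) 1 w - X w)\<^sup>2) \<partial>completion \<gamma>)
           \<longlonglongrightarrow> 0))"

text \<open>
  The convention \<open>[h](w + k) = [h](w) + \<langle>h,k\<rangle>\<close> for shifts \<open>k\<close> in the Cameron--Martin space.
  The exceptional null set may depend on \<open>h\<close> but not on \<open>k\<close>, so that random shifts
  \<open>k = Z w\<close> are covered. Such versions of the Wiener integral exist, for instance the pathwise
  limits of the integrals of the dyadic averages of \<open>deriv h\<close>.
\<close>

definition shift_rule :: "path measure \<Rightarrow> (path \<Rightarrow> path \<Rightarrow> real) \<Rightarrow> bool" where
  "shift_rule \<gamma> I \<longleftrightarrow>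
     (\<forall>h\<in>cameron_martin. AE w in \<gamma>. \<forall>k\<in>cameron_martin. I h (w + k) = I h w + cm_inner h k)"

text \<open>The canonical filtration, augmented by the null sets of the completed Wiener measure.\<close>

definition wiener_filtration :: "path measure \<Rightarrow> real \<Rightarrow> path measure" where
  "wiener_filtration \<gamma> t =
     sigma (space \<gamma>)
       ({(\<lambda>w :: path. w s) -` A \<inter> space \<gamma> | s A. s \<in> {0..t} \<and> A \<in> sets borel} \<union>
        null_sets (completion \<gamma>))"

definition predictable_sigma :: "path measure \<Rightarrow> (real \<times> path) measure" where
  "predictable_sigma \<gamma> =
     sigma ({0..1} \<times> space \<gamma>)
       ({{0} \<times> A | A. A \<in> sets (wiener_filtration \<gamma> 0)} \<union>
        {{s<..t} \<times> A | s t A. 0 \<le> s \<and> s \<le> t \<and> t \<le> 1 \<and> A \<in> sets (wiener_filtration \<gamma> s)})"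

definition predictable_process :: "path measure \<Rightarrow> (real \<Rightarrow> path \<Rightarrow> real) \<Rightarrow> bool" where
  "predictable_process \<gamma> H \<longleftrightarrow> case_prod H \<in> borel_measurable (predictable_sigma \<gamma>)"

definition simple_predictable ::
  "path measure \<Rightarrow> nat \<Rightarrow> (nat \<Rightarrow> real) \<Rightarrow> (nat \<Rightarrow> path \<Rightarrow> real) \<Rightarrow> bool" where
  "simple_predictable \<gamma> k \<tau> \<xi> \<longleftrightarrow>
     partition_01 k \<tau> \<and>
     (\<forall>i<k. \<xi> i \<in> borel_measurable (wiener_filtration \<gamma> (\<tau> i)) \<and> bounded (\<xi> i ` space \<gamma>))"

text \<open>
  \<open>X\<close> is a continuous version of the Ito integral process of \<open>H\<close>, where \<open>H\<close> is predictable
  with almost surely square-integrable paths. It is obtained from simple predictable processes that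
  converge to \<open>H\<close> in \<open>L\<^sup>2[0,1]\<close>, in probability.
\<close>

definition ito_integral ::
  "path measure \<Rightarrow> (real \<Rightarrow> path \<Rightarrow> real) \<Rightarrow> (real \<Rightarrow> path \<Rightarrow> real) \<Rightarrow> bool" where
  "ito_integral \<gamma> H X \<longleftrightarrow>
     (\<forall>t\<in>{0..1}. X t \<in> borel_measurable (wiener_filtration \<gamma> t)) \<and>
     (AE w in completion \<gamma>. continuous_on {0..1} (\<lambda>t. X t w)) \<and>
     (\<exists>k \<tau> \<xi>.
        (\<forall>m. simple_predictable \<gamma> (k m) (\<tau> m) (\<xi> m)) \<and>
        (\<forall>\<epsilon>>0. (\<lambda>m. measure (completion \<gamma>)
             {w \<in> space \<gamma>. (\<integral>\<^sup>+s\<in>{0..1}. ennreal ((step_process (k m) (\<tau> m) (\<xi> m) s w - H s w)\<^sup>2) \<partial>lborel)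
                 > ennreal \<epsilon>}) \<longlonglongrightarrow> 0) \<and>
        (\<forall>t\<in>{0..1}. \<forall>\<epsilon>>0. (\<lambda>m. measure (completion \<gamma>)
             {w \<in> space \<gamma>. \<bar>step_integral (k m) (\<tau> m) (\<xi> m) t w - X t w\<bar> > \<epsilon>}) \<longlonglongrightarrow> 0))"

definition martingale_01 :: "path measure \<Rightarrow> (real \<Rightarrow> path \<Rightarrow> real) \<Rightarrow> bool" where
  "martingale_01 \<gamma> M \<longleftrightarrow>
     (\<forall>t\<in>{0..1}. M t \<in> borel_measurable (wiener_filtration \<gamma> t) \<and>
        integrable (completion \<gamma>) (M t)) \<and>
     (\<forall>s\<in>{0..1}. \<forall>t\<in>{0..1}. s \<le> t \<longrightarrow>
        (AE w in completion \<gamma>.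
           real_cond_exp (completion \<gamma>) (wiener_filtration \<gamma> s) (M t) w = M s w))"

text \<open>
  The standing assumptions on the shift. The pathwise derivative of \<open>Z w\<close> exists only for almost
  every time, so predictability refers to a process \<open>\<zeta>\<close> that represents it.
\<close>

definition predictable_shift :: "path measure \<Rightarrow> (path \<Rightarrow> path) \<Rightarrow> bool" where
  "predictable_shift \<gamma> Z \<longleftrightarrow>
     (AE w in \<gamma>. Z w \<in> cameron_martin) \<and>
     (\<exists>\<zeta>. predictable_process \<gamma> \<zeta> \<and>
        (AE w in \<gamma>. AE t in lborel. t \<in> {0..1} \<longrightarrow> \<zeta> t w = deriv (Z w) t) \<and>
        (AE w in \<gamma>. set_integrable lborel {0..1} (\<lambda>t. (\<zeta> t w)\<^sup>2)) \<and>
        (\<exists>X. ito_integral \<gamma> \<zeta> X \<and>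
           martingale_01 \<gamma> (\<lambda>t w. exp (X t w - (LINT s:{0..t}|lborel. (\<zeta> s w)\<^sup>2) / 2))))"


section \<open>Polynomial functionals and the operators acting on them\<close>

text \<open>Real polynomials in the variables \<open>x 0, \<dots>, x (n - 1)\<close>.\<close>

definition real_polynomial :: "nat \<Rightarrow> ((nat \<Rightarrow> real) \<Rightarrow> real) \<Rightarrow> bool" where
  "real_polynomial n p \<longleftrightarrow>
     (\<exists>(A :: (nat \<Rightarrow> nat) set) c. finite A \<and>
        (\<forall>x. p x = (\<Sum>\<alpha>\<in>A. c \<alpha> * (\<Prod>i<n. x i ^ \<alpha> i))))"

definition polynomial_functionals :: "(path \<Rightarrow> path \<Rightarrow> real) \<Rightarrow> (path \<Rightarrow> real) set" where
  "polynomial_functionals I =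
     {\<lambda>w. p (\<lambda>i. I (h i) w) | n p h. real_polynomial n p \<and> (\<forall>i<n. h i \<in> cameron_martin)}"

definition dir_deriv :: "path \<Rightarrow> (path \<Rightarrow> real) \<Rightarrow> path \<Rightarrow> real" where
  "dir_deriv \<theta> F w = Lim (at 0) (\<lambda>\<epsilon>. (F (w + \<epsilon> *\<^sub>R \<theta>) - F w) / \<epsilon>)"

text \<open>
  The summand of the n-th tensor power of \<open>D\<^sub>Z\<close>. A multi-index is a list \<open>[i\<^sub>1, \<dots>, i\<^sub>n]\<close>.
\<close>

definition D_term ::
  "(nat \<Rightarrow> path) \<Rightarrow> (path \<Rightarrow> path) \<Rightarrow> (path \<Rightarrow> real) \<Rightarrow> path \<Rightarrow> nat list \<Rightarrow> real" where
  "D_term e Z F w js =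
     (\<Prod>i\<leftarrow>js. cm_inner (Z w) (e i)) * foldr (\<lambda>i. dir_deriv (e i)) js F w"

definition D_power ::
  "(nat \<Rightarrow> path) \<Rightarrow> (path \<Rightarrow> path) \<Rightarrow> nat \<Rightarrow> (path \<Rightarrow> real) \<Rightarrow> path \<Rightarrow> real" where
  "D_power e Z n F w = (\<Sum>\<^sub>\<infinity>js\<in>{js. length js = n}. D_term e Z F w js)"

definition exp_D ::
  "(nat \<Rightarrow> path) \<Rightarrow> (path \<Rightarrow> path) \<Rightarrow> (path \<Rightarrow> real) \<Rightarrow> path \<Rightarrow> real" where
  "exp_D e Z F w = (\<Sum>n. D_power e Z n F w / fact n)"

end

theory Submission
  imports Defs
begin

text \<open>
  By the shift rule, for almost every path \<open>w\<close> the functional \<open>f\<close> restricted to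
  \<open>w + cameron_martin\<close> is a polynomial \<open>p\<close> in the numbers \<open>x\<^sub>j + \<langle>h\<^sub>j, k\<rangle>\<close>. There, directional
  derivatives of \<open>f\<close> along \<open>e\<^sub>i\<close> are those of \<open>p\<close> along the vector \<open>v\<^sub>i = (\<langle>h\<^sub>j, e\<^sub>i\<rangle>)\<^sub>j\<close>. They are linear
  in \<open>v\<^sub>i\<close>, and \<open>\<Sum>\<^sub>i \<langle>Z, e\<^sub>i\<rangle> v\<^sub>i = (\<langle>h\<^sub>j, Z\<rangle>)\<^sub>j =: u\<close> by Parseval's identity, so the n-th tensor
  power of \<open>D\<^sub>Z\<close> is the n-th derivative of \<open>p\<close> along \<open>u\<close>. The exponential series is therefore the
  Taylor expansion of the univariate polynomial \<open>t \<mapsto> p (x + t u)\<close> at \<open>0\<close>, evaluated at \<open>t = 1\<close>.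
\<close>

subsection \<open>Unconditional sums\<close>

text \<open>Unconditional summability of a real family is absolute. The absolute values of the
  products can therefore be summed in iterated form, which makes the product family summable over
  \<open>A \<times> B\<close>, and its value is then the iterated sum.\<close>

lemma has_sum_mult_real:
  fixes f :: "'a \<Rightarrow> real" and g :: "'b \<Rightarrow> real"
  assumes "(f has_sum a) A" and "(g has_sum b) B"
  shows "((\<lambda>(x, y). f x * g y) has_sum a * b) (A \<times> B)"
proof (rule has_sum_SigmaI)
  show "((\<lambda>y. case (x, y) of (x, y) \<Rightarrow> f x * g y) has_sum f x * b) B" for x
    using has_sum_cmult_right[OF assms(2)] by simp
  show "((\<lambda>x. f x * b) has_sum a * b) A"
    by (rule has_sum_cmult_left[OF assms(1)])
  have f: "(\<lambda>x. \<bar>f x\<bar>) summable_on A" and g: "(\<lambda>y. \<bar>g y\<bar>) summable_on B"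
    using assms summable_on_iff_abs_summable_on_real[of f A] summable_on_iff_abs_summable_on_real[of g B]
    by (auto dest: has_sum_imp_summable)
  have "(\<lambda>(x, y). \<bar>f x\<bar> * \<bar>g y\<bar>) summable_on (A \<times> B)"
  proof (rule summable_on_SigmaI)
    show "((\<lambda>y. case (x, y) of (x, y) \<Rightarrow> \<bar>f x\<bar> * \<bar>g y\<bar>) has_sum \<bar>f x\<bar> * (\<Sum>\<^sub>\<infinity>y\<in>B. \<bar>g y\<bar>)) B" for x
      using has_sum_cmult_right[OF has_sum_infsum[OF g]] by simp
    show "(\<lambda>x. \<bar>f x\<bar> * (\<Sum>\<^sub>\<infinity>y\<in>B. \<bar>g y\<bar>)) summable_on A"
      by (rule summable_on_cmult_left[OF f])
  qed auto
  then show "(\<lambda>(x, y). f x * g y) summable_on (A \<times> B)"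
    by (subst summable_on_iff_abs_summable_on_real) (simp add: case_prod_unfold abs_mult)
qed

lemma has_sum_finite_sum:
  fixes f :: "'i \<Rightarrow> 'a \<Rightarrow> 'b :: topological_comm_monoid_add"
  assumes "\<And>i. i \<in> J \<Longrightarrow> (f i has_sum s i) A"
  shows "((\<lambda>x. \<Sum>i\<in>J. f i x) has_sum (\<Sum>i\<in>J. s i)) A"
  using assms by (induction J rule: infinite_finite_induct) (auto intro: has_sum_add)

lemma has_sum_diff_real:
  fixes f g :: "'a \<Rightarrow> real"
  assumes "(f has_sum a) A" and "(g has_sum b) A"
  shows "((\<lambda>x. f x - g x) has_sum a - b) A"
  using has_sum_add[OF assms(1) has_sum_cmult_right[OF assms(2), of "-1"]] by simp


subsection \<open>Directional derivatives of polynomials\<close>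

text \<open>Closure rules replace the monomial expansion of \<open>real_polynomial\<close>, so that
  derivatives and restrictions to lines can be handled by induction through the sum and product
  rules, without tracking exponents.\<close>

inductive polynomial_fun :: "nat \<Rightarrow> ((nat \<Rightarrow> real) \<Rightarrow> real) \<Rightarrow> bool" for n where
  const: "polynomial_fun n (\<lambda>x. c)"
| coord: "j < n \<Longrightarrow> polynomial_fun n (\<lambda>x. x j)"
| add: "polynomial_fun n p \<Longrightarrow> polynomial_fun n q \<Longrightarrow> polynomial_fun n (\<lambda>x. p x + q x)"
| mult: "polynomial_fun n p \<Longrightarrow> polynomial_fun n q \<Longrightarrow> polynomial_fun n (\<lambda>x. p x * q x)"

lemma polynomial_fun_sum:
  assumes "\<And>i. i \<in> A \<Longrightarrow> polynomial_fun n (p i)"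
  shows "polynomial_fun n (\<lambda>x. \<Sum>i\<in>A. p i x)"
  using assms by (induction A rule: infinite_finite_induct) (auto intro: polynomial_fun.intros)

lemma polynomial_fun_prod:
  assumes "\<And>i. i \<in> A \<Longrightarrow> polynomial_fun n (p i)"
  shows "polynomial_fun n (\<lambda>x. \<Prod>i\<in>A. p i x)"
  using assms by (induction A rule: infinite_finite_induct) (auto intro: polynomial_fun.intros)

lemma polynomial_fun_power:
  assumes "polynomial_fun n p"
  shows "polynomial_fun n (\<lambda>x. p x ^ m)"
  using assms by (induction m) (auto intro: polynomial_fun.intros)

lemma real_polynomial_imp_polynomial_fun:
  assumes "real_polynomial n p"
  shows "polynomial_fun n p"
proof -
  obtain A c where p: "p = (\<lambda>x. \<Sum>\<alpha>\<in>A. c \<alpha> * (\<Prod>i<n. x i ^ \<alpha> i))"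
    using assms unfolding real_polynomial_def fun_eq_iff by blast
  show ?thesis unfolding p
    by (intro polynomial_fun_sum polynomial_fun_prod polynomial_fun_power polynomial_fun.intros) auto
qed

text \<open>Allows arguments to be compared below \<open>n\<close> only. In the applications the
  paths \<open>h j\<close> with \<open>j \<ge> n\<close> are arbitrary, and the shift rule and
  additivity of \<open>cm_inner\<close> are available only for the others.\<close>

lemma polynomial_fun_cong:
  assumes "polynomial_fun n p" and "\<And>j. j < n \<Longrightarrow> x j = y j"
  shows "p x = p y"
  using assms by induction auto

text \<open>The \<open>q j\<close> are the partial derivatives. They are chosen before
  \<open>x\<close> and \<open>v\<close>, so the derivative is visibly linear in the
  direction.\<close>

lemma polynomial_fun_gradient:
  assumes "polynomial_fun n p"
  shows "\<exists>q. (\<forall>j. polynomial_fun n (q j)) \<and>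
    (\<forall>x v. ((\<lambda>t. p (\<lambda>i. x i + t * v i)) has_real_derivative (\<Sum>j<n. v j * q j x)) (at 0))"
  using assms
proof induction
  case (const c)
  show ?case
    by (rule exI[of _ "\<lambda>j x. 0"]) (auto intro: polynomial_fun.intros)
next
  case (coord j)
  have "((\<lambda>t. x j + t * v j) has_real_derivative (\<Sum>i<n. v i * of_bool (i = j))) (at 0)"
    for x v :: "nat \<Rightarrow> real"
    using coord by (auto intro!: derivative_eq_intros simp: of_bool_def if_distrib cong: if_cong)
  then show ?case
    by (intro exI[of _ "\<lambda>i x. of_bool (i = j)"]) (auto intro: polynomial_fun.intros)
next
  case (add p1 p2)
  then obtain q1 q2 where q1: "\<forall>j. polynomial_fun n (q1 j)"
      "\<And>x v. ((\<lambda>t. p1 (\<lambda>i. x i + t * v i)) has_real_derivative (\<Sum>j<n. v j * q1 j x)) (at 0)"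
    and q2: "\<forall>j. polynomial_fun n (q2 j)"
      "\<And>x v. ((\<lambda>t. p2 (\<lambda>i. x i + t * v i)) has_real_derivative (\<Sum>j<n. v j * q2 j x)) (at 0)"
    by blast
  show ?case
    using q1(1) q2(1)
    by (intro exI[of _ "\<lambda>j x. q1 j x + q2 j x"])
      (auto intro: polynomial_fun.intros simp: ring_distribs sum.distrib
        intro!: DERIV_add q1(2) q2(2))
next
  case (mult p1 p2)
  then obtain q1 q2 where q1: "\<forall>j. polynomial_fun n (q1 j)"
      "\<And>x v. ((\<lambda>t. p1 (\<lambda>i. x i + t * v i)) has_real_derivative (\<Sum>j<n. v j * q1 j x)) (at 0)"
    and q2: "\<forall>j. polynomial_fun n (q2 j)"
      "\<And>x v. ((\<lambda>t. p2 (\<lambda>i. x i + t * v i)) has_real_derivative (\<Sum>j<n. v j * q2 j x)) (at 0)"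
    by blast
  have "((\<lambda>t. p1 (\<lambda>i. x i + t * v i) * p2 (\<lambda>i. x i + t * v i)) has_real_derivative
      (\<Sum>j<n. v j * (q1 j x * p2 x + p1 x * q2 j x))) (at 0)" for x v
    using DERIV_mult[OF q1(2)[of x v] q2(2)[of x v]]
    by (simp add: ring_distribs sum.distrib sum_distrib_left sum_distrib_right algebra_simps)
  moreover have "polynomial_fun n (\<lambda>x. q1 j x * p2 x + p1 x * q2 j x)" for j
    using q1(1) q2(1) mult.hyps by (intro polynomial_fun.add polynomial_fun.mult) auto
  ultimately show ?case
    by (intro exI[of _ "\<lambda>j x. q1 j x * p2 x + p1 x * q2 j x"]) auto
qed

text \<open>Defined through the total function \<open>deriv\<close>, so that it acts on arbitrary
  functions and can be iterated by \<open>foldr\<close>; for polynomials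
  \<open>has_real_derivative_dird\<close> guarantees that the derivative exists.\<close>

definition dird :: "(nat \<Rightarrow> real) \<Rightarrow> ((nat \<Rightarrow> real) \<Rightarrow> real) \<Rightarrow> (nat \<Rightarrow> real) \<Rightarrow> real" where
  "dird v p x = deriv (\<lambda>t. p (\<lambda>i. x i + t * v i)) 0"

lemma polynomial_fun_dird:
  assumes "polynomial_fun n p"
  obtains q where "\<And>j. polynomial_fun n (q j)"
    and "\<And>v. dird v p = (\<lambda>x. \<Sum>j<n. v j * q j x)"
proof -
  obtain q where "\<forall>j. polynomial_fun n (q j)"
    and "\<forall>x v. ((\<lambda>t. p (\<lambda>i. x i + t * v i)) has_real_derivative (\<Sum>j<n. v j * q j x)) (at 0)"
    using polynomial_fun_gradient[OF assms] by blast
  then show ?thesis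
    by (intro that[of q]) (auto simp: dird_def fun_eq_iff intro!: DERIV_imp_deriv)
qed

lemma polynomial_fun_dird_closed:
  assumes "polynomial_fun n p"
  shows "polynomial_fun n (dird v p)"
proof -
  obtain q where "\<And>j. polynomial_fun n (q j)" "dird v p = (\<lambda>x. \<Sum>j<n. v j * q j x)"
    using polynomial_fun_dird[OF assms] by metis
  then show ?thesis
    by (auto intro!: polynomial_fun_sum polynomial_fun.mult polynomial_fun.const)
qed

lemma polynomial_fun_foldr_dird:
  assumes "polynomial_fun n p"
  shows "polynomial_fun n (foldr dird vs p)"
  using assms by (induction vs) (auto intro: polynomial_fun_dird_closed)

lemma has_real_derivative_dird:
  assumes "polynomial_fun n p"
  shows "((\<lambda>t. p (\<lambda>i. x i + t * v i)) has_real_derivative dird v p x) (at 0)"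
proof -
  obtain g where "((\<lambda>t. p (\<lambda>i. x i + t * v i)) has_real_derivative g) (at 0)"
    using polynomial_fun_gradient[OF assms] by blast
  then show ?thesis
    by (simp add: dird_def DERIV_imp_deriv)
qed

text \<open>In use, \<open>c\<close> is a direction and \<open>q\<close> the family of partial
  derivatives: the outer derivatives are moved past the expansion of the innermost one.\<close>

lemma foldr_dird_sum:
  assumes "\<And>j. j \<in> A \<Longrightarrow> polynomial_fun n (q j)"
  shows "foldr dird vs (\<lambda>x. \<Sum>j\<in>A. c j * q j x) = (\<lambda>x. \<Sum>j\<in>A. c j * foldr dird vs (q j) x)"
proof (induction vs)
  case (Cons v vs)
  have "((\<lambda>t. \<Sum>j\<in>A. c j * foldr dird vs (q j) (\<lambda>i. x i + t * v i)) has_real_derivative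
      (\<Sum>j\<in>A. c j * dird v (foldr dird vs (q j)) x)) (at 0)" for x
    by (intro DERIV_sum DERIV_cmult has_real_derivative_dird[where n = n]
        polynomial_fun_foldr_dird assms)
  from DERIV_imp_deriv[OF this] show ?case
    by (simp add: Cons dird_def[of v "\<lambda>x. \<Sum>j\<in>A. _ j x", abs_def])
qed simp

text \<open>
  The induction splits off the last index, the one whose derivative is taken first: only linearity
  of \<open>dird v p\<close> in \<open>v\<close> is then used, and no symmetry of mixed derivatives.
\<close>

lemma has_sum_iterated_dird:
  fixes v :: "nat \<Rightarrow> nat \<Rightarrow> real"
  assumes "\<And>j. j < n \<Longrightarrow> ((\<lambda>i. z i * v i j) has_sum u j) UNIV"
    and "polynomial_fun n p"
  shows "((\<lambda>is. (\<Prod>i\<leftarrow>is. z i) * foldr dird (map v is) p x) has_sum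
           foldr dird (replicate N u) p x) {is. length is = N}"
  using assms(2)
proof (induction N arbitrary: p)
  case 0
  have "{is :: nat list. length is = 0} = {[]}"
    by auto
  then show ?case
    using has_sum_finite[of "{[]}" "\<lambda>is. (\<Prod>i\<leftarrow>is. z i) * foldr dird (map v is) p x"] by simp
next
  case (Suc N)
  obtain q where q: "\<And>j. polynomial_fun n (q j)" "\<And>v. dird v p = (\<lambda>x. \<Sum>j<n. v j * q j x)"
    using polynomial_fun_dird[OF Suc.prems] by metis
  let ?T = "\<lambda>j is. (\<Prod>i\<leftarrow>is. z i) * foldr dird (map v is) (q j) x"
  \<comment> \<open>The innermost derivative along \<open>v i\<close> is
    \<open>\<Sum>j<n. v i j * q j x\<close>, so each summand factors into a part in \<open>i\<close>
    and a part in \<open>is\<close>. The first sums to \<open>u j\<close> by assumption, the second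
    by induction applied to \<open>q j\<close>.\<close>
  have "((\<lambda>y. \<Sum>j<n. case y of (i, is) \<Rightarrow> z i * v i j * ?T j is) has_sum
      (\<Sum>j<n. u j * foldr dird (replicate N u) (q j) x)) (UNIV \<times> {is. length is = N})"
    by (intro has_sum_finite_sum has_sum_mult_real assms(1) Suc.IH q(1)) auto
  \<comment> \<open>A copy of \<open>u\<close> is moved to the end of the list, where
    \<open>foldr\<close> applies it first.\<close>
  also have "(\<Sum>j<n. u j * foldr dird (replicate N u) (q j) x) = foldr dird (replicate (Suc N) u) p x"
    by (simp only: replicate_Suc replicate_append_same[symmetric] foldr_append foldr.simps o_apply
        id_apply q(2) foldr_dird_sum[OF q(1)])
  also have "(\<lambda>y. \<Sum>j<n. case y of (i, is) \<Rightarrow> z i * v i j * ?T j is) =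
      (\<lambda>is. (\<Prod>i\<leftarrow>is. z i) * foldr dird (map v is) p x) \<circ> (\<lambda>(i, is). is @ [i])"
    by (simp add: fun_eq_iff q(2) foldr_dird_sum[OF q(1)] sum_distrib_left)
      (simp add: ac_simps)
  finally have "((\<lambda>is. (\<Prod>i\<leftarrow>is. z i) * foldr dird (map v is) p x) has_sum
      foldr dird (replicate (Suc N) u) p x) ((\<lambda>(i, is). is @ [i]) ` (UNIV \<times> {is. length is = N}))"
    by (subst has_sum_reindex) (fastforce simp: inj_on_def)+
  also have "(\<lambda>(i, is). is @ [i]) ` (UNIV \<times> {is. length is = N}) = {is :: nat list. length is = Suc N}"
    by (auto simp: image_iff length_Suc_conv_rev)
  finally show ?case .
qed

section \<open>Taylor coefficients along a line\<close>

lemma polynomial_fun_line: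
  assumes "polynomial_fun n p"
  shows "\<exists>r. \<forall>t. p (\<lambda>i. x i + t * u i) = poly r t"
  using assms
proof induction
  case (const c)
  show ?case by (rule exI[of _ "[:c:]"]) simp
next
  case (coord j)
  show ?case by (rule exI[of _ "[:x j, u j:]"]) simp
next
  case (add p q)
  then show ?case by (metis poly_add)
next
  case (mult p q)
  then show ?case by (metis poly_mult)
qed

text \<open>On the line through \<open>x\<close> with direction \<open>u\<close>, a derivative along
  \<open>u\<close> is a derivative in the parameter. The induction must cover every
  \<open>t\<close>, because \<open>deriv\<close> inspects neighbouring points of the line.\<close>

lemma foldr_dird_replicate_line:
  assumes "\<And>t. p (\<lambda>i. x i + t * u i) = poly r t"
  shows "foldr dird (replicate N u) p (\<lambda>i. x i + t * u i) = poly ((pderiv ^^ N) r) t"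
proof (induction N arbitrary: t)
  case (Suc N)
  have "(\<lambda>i. x i + t * u i + s * u i) = (\<lambda>i. x i + (t + s) * u i)" for s
    by (simp add: algebra_simps)
  then have "foldr dird (replicate (Suc N) u) p (\<lambda>i. x i + t * u i) =
      deriv (\<lambda>s. poly ((pderiv ^^ N) r) (t + s)) 0"
    by (simp only: replicate.simps foldr.simps o_apply dird_def Suc.IH)
  also have "\<dots> = poly (pderiv ((pderiv ^^ N) r)) t"
    by (auto intro!: DERIV_imp_deriv derivative_eq_intros)
  finally show ?case by simp
qed (simp add: assms)

lemma foldr_dird_replicate_coeff:
  assumes "\<And>t. p (\<lambda>i. x i + t * u i) = poly r t"
  shows "foldr dird (replicate N u) p x = fact N * coeff r N"
  using foldr_dird_replicate_line[where t = 0, OF assms, of N]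
  by (simp add: poly_0_coeff_0 coeff_higher_pderiv pochhammer_fact)


subsection \<open>Borel measurability of derivatives\<close>

text \<open>The Cauchy criterion for the difference quotients. It does not mention the limit, and
  its outer quantifiers range over naturals, so it describes the points of differentiability by
  countable set operations.\<close>

lemma field_differentiable_iff_difference_quotients_Cauchy:
  fixes f :: "real \<Rightarrow> real"
  shows "f field_differentiable at x \<longleftrightarrow>
    (\<forall>n. \<exists>m. \<forall>u v. 0 < \<bar>u\<bar> \<and> \<bar>u\<bar> < 1 / Suc m \<and> 0 < \<bar>v\<bar> \<and> \<bar>v\<bar> < 1 / Suc m \<longrightarrow>
      \<bar>(f (x + u) - f x) / u - (f (x + v) - f x) / v\<bar> \<le> 1 / Suc n)" (is "_ \<longleftrightarrow> ?Cauchy")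
proof
  let ?q = "\<lambda>u. (f (x + u) - f x) / u"
  assume "f field_differentiable at x"
  then obtain L where "?q \<midarrow>0\<rightarrow> L"
    by (auto simp: field_differentiable_def DERIV_def)
  then have L: "\<exists>d>0. \<forall>u. 0 < \<bar>u\<bar> \<and> \<bar>u\<bar> < d \<longrightarrow> \<bar>?q u - L\<bar> < r" if "r > 0" for r
    using that by (simp add: LIM_def dist_real_def)
  show ?Cauchy
  proof
    fix n
    obtain d where "d > 0" and d: "\<And>u. 0 < \<bar>u\<bar> \<Longrightarrow> \<bar>u\<bar> < d \<Longrightarrow> \<bar>?q u - L\<bar> < 1 / Suc n / 2"
      using L[of "1 / Suc n / 2"] by auto
    obtain m where m: "1 / Suc m < d"
      using \<open>d > 0\<close> nat_approx_posE by blast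
    have "\<bar>?q u - ?q v\<bar> \<le> 1 / Suc n"
      if "0 < \<bar>u\<bar> \<and> \<bar>u\<bar> < 1 / Suc m \<and> 0 < \<bar>v\<bar> \<and> \<bar>v\<bar> < 1 / Suc m" for u v
    proof -
      have "\<bar>?q u - L\<bar> < 1 / Suc n / 2" "\<bar>?q v - L\<bar> < 1 / Suc n / 2"
        by (rule d; use that m in linarith)+
      moreover have "\<bar>a - b\<bar> \<le> r" if "\<bar>a - L\<bar> < r / 2" and "\<bar>b - L\<bar> < r / 2" for a b r
        using that by linarith
      ultimately show ?thesis by blast
    qed
    then show "\<exists>m. \<forall>u v. 0 < \<bar>u\<bar> \<and> \<bar>u\<bar> < 1 / Suc m \<and> 0 < \<bar>v\<bar> \<and> \<bar>v\<bar> < 1 / Suc m \<longrightarrow>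
        \<bar>?q u - ?q v\<bar> \<le> 1 / Suc n"
      by blast
  qed
next
  let ?q = "\<lambda>u. (f (x + u) - f x) / u"
  assume C: ?Cauchy
  have near: "\<exists>d>0. \<forall>u v. 0 < \<bar>u\<bar> \<and> \<bar>u\<bar> < d \<and> 0 < \<bar>v\<bar> \<and> \<bar>v\<bar> < d \<longrightarrow> \<bar>?q u - ?q v\<bar> < r"
    if r: "r > 0" for r
  proof -
    obtain n where n: "1 / Suc n < r"
      using r nat_approx_posE by blast
    obtain m where m: "\<And>u v. 0 < \<bar>u\<bar> \<and> \<bar>u\<bar> < 1 / Suc m \<and> 0 < \<bar>v\<bar> \<and> \<bar>v\<bar> < 1 / Suc m \<Longrightarrow>
        \<bar>?q u - ?q v\<bar> \<le> 1 / Suc n"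
      using C by blast
    show ?thesis
    proof (intro exI[of _ "1 / Suc m"] conjI allI impI)
      fix u v
      assume "0 < \<bar>u\<bar> \<and> \<bar>u\<bar> < 1 / Suc m \<and> 0 < \<bar>v\<bar> \<and> \<bar>v\<bar> < 1 / Suc m"
      from m[OF this] n show "\<bar>?q u - ?q v\<bar> < r"
        by linarith
    qed simp
  qed
  have "\<exists>L. (?q \<longlongrightarrow> L) (at 0)"
  proof -
    \<comment> \<open>A sequence of nonzero increments tending to \<open>0\<close> produces the
      candidate limit \<open>L\<close>; an arbitrary small increment is then compared with a late
      member of this sequence.\<close>
    define s where "s k = 1 / real (Suc k)" for k
    have s0: "s \<longlonglongrightarrow> 0"
      unfolding s_def by (rule LIMSEQ_Suc[OF lim_1_over_n])
    have sd: "\<exists>K. \<forall>k\<ge>K. 0 < \<bar>s k\<bar> \<and> \<bar>s k\<bar> < d" if "d > 0" for d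
      using LIMSEQ_D[OF s0 that] by (auto simp: s_def)
    have "Cauchy (\<lambda>k. ?q (s k))"
    proof (rule metric_CauchyI)
      fix r :: real
      assume "r > 0"
      then obtain d where "d > 0"
        and d: "\<And>u v. 0 < \<bar>u\<bar> \<and> \<bar>u\<bar> < d \<and> 0 < \<bar>v\<bar> \<and> \<bar>v\<bar> < d \<Longrightarrow> \<bar>?q u - ?q v\<bar> < r"
        using near by blast
      then show "\<exists>M. \<forall>m\<ge>M. \<forall>k\<ge>M. dist (?q (s m)) (?q (s k)) < r"
        unfolding dist_real_def using sd[OF \<open>d > 0\<close>] by blast
    qed
    then obtain L where L: "(\<lambda>k. ?q (s k)) \<longlonglongrightarrow> L"
      using Cauchy_convergent convergentD by blast
    have "?q \<midarrow>0\<rightarrow> L"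
    proof (rule LIM_I)
      fix r :: real
      assume "r > 0"
      then obtain d where "d > 0"
        and d: "\<And>u v. 0 < \<bar>u\<bar> \<and> \<bar>u\<bar> < d \<and> 0 < \<bar>v\<bar> \<and> \<bar>v\<bar> < d \<Longrightarrow> \<bar>?q u - ?q v\<bar> < r / 2"
        using near[of "r / 2"] by auto
      obtain K where K: "\<And>k. k \<ge> K \<Longrightarrow> 0 < \<bar>s k\<bar> \<and> \<bar>s k\<bar> < d"
        using sd[OF \<open>d > 0\<close>] by blast
      obtain K' where K': "\<And>k. k \<ge> K' \<Longrightarrow> norm (?q (s k) - L) < r / 2"
        using LIMSEQ_D[OF L, of "r / 2"] \<open>r > 0\<close> by auto
      let ?k = "max K K'"
      have "norm (?q u - L) < r" if "u \<noteq> 0 \<and> norm (u - 0) < d" for u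
      proof -
        have "\<bar>?q u - ?q (s ?k)\<bar> < r / 2" "\<bar>?q (s ?k) - L\<bar> < r / 2"
          using d[of u "s ?k"] K[of ?k] K'[of ?k] that by simp_all
        moreover have "\<bar>a - L\<bar> < r" if "\<bar>a - b\<bar> < r / 2" and "\<bar>b - L\<bar> < r / 2" for a b
          using that by linarith
        ultimately show ?thesis
          unfolding real_norm_def by blast
      qed
      then show "\<exists>d>0. \<forall>u. u \<noteq> 0 \<and> norm (u - 0) < d \<longrightarrow> norm (?q u - L) < r"
        using \<open>d > 0\<close> by blast
    qed
    then show ?thesis by blast
  qed
  then show "f field_differentiable at x"
    by (auto simp: field_differentiable_def DERIV_def)
qed

text \<open>For fixed \<open>n\<close> and \<open>m\<close> the condition is an intersection, over
  all \<open>u\<close> and \<open>v\<close>, of sets closed by continuity of \<open>f\<close>. Only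
  the union over \<open>m\<close> and the intersection over \<open>n\<close> remain, and these are
  countable.\<close>

lemma borel_field_differentiable:
  fixes f :: "real \<Rightarrow> real"
  assumes f: "continuous_on UNIV f"
  shows "{x. f field_differentiable at x} \<in> sets borel"
proof -
  have c: "continuous_on UNIV (\<lambda>x. f (x + u))" for u
    by (rule continuous_on_compose2[OF f]) (auto intro: continuous_intros)
  let ?C = "\<lambda>n m. {x. \<forall>u v. 0 < \<bar>u\<bar> \<and> \<bar>u\<bar> < 1 / Suc m \<and> 0 < \<bar>v\<bar> \<and> \<bar>v\<bar> < 1 / Suc m \<longrightarrow>
      \<bar>(f (x + u) - f x) / u - (f (x + v) - f x) / v\<bar> \<le> 1 / Suc n}"
  have "closed (?C n m)" for n m
    \<comment> \<open>With \<open>u\<close> and \<open>v\<close> fixed, the division becomes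
      multiplication by a constant, so continuity in \<open>x\<close> carries no side condition that
      they be nonzero.\<close>
    unfolding divide_inverse
    by (intro closed_Collect_all closed_Collect_imp open_Collect_const closed_Collect_le
        continuous_intros c f)
  then have "(\<Inter>n. \<Union>m. ?C n m) \<in> sets borel"
    by (intro sets.countable_INT'' sets.countable_UN' borel_closed) auto
  also have "(\<Inter>n. \<Union>m. ?C n m) = {x. f field_differentiable at x}"
    unfolding field_differentiable_iff_difference_quotients_Cauchy by blast
  finally show ?thesis .
qed

text \<open>
  Where \<open>f\<close> is not differentiable, \<open>deriv f\<close> takes the constant junk value \<open>SOME D. False\<close>, so no
  modification on a null set is needed.
\<close>

lemma borel_measurable_deriv:
  fixes f :: "real \<Rightarrow> real"
  assumes f: "continuous_on UNIV f"
  shows "deriv f \<in> borel_measurable borel"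
proof -
  let ?D = "{x. f field_differentiable at x}"
  \<comment> \<open>Measurable functions converging to \<open>deriv f\<close> at every point:
    difference quotients with increment \<open>1 / Suc k\<close> on \<open>?D\<close>, the default
    value elsewhere.\<close>
  define q where "q k x = (if x \<in> ?D then (f (x + 1 / Suc k) - f x) / (1 / Suc k)
      else SOME D :: real. False)" for k :: nat and x
  have c: "continuous_on UNIV (\<lambda>x. f (x + u))" for u
    by (rule continuous_on_compose2[OF f]) (auto intro: continuous_intros)
  have "q k \<in> borel_measurable borel" for k
    unfolding q_def using borel_field_differentiable[OF f]
    by (intro measurable_If_set borel_measurable_continuous_onI continuous_intros c f) auto
  moreover have "(\<lambda>k. q k x) \<longlonglongrightarrow> deriv f x" for x
  proof (cases "x \<in> ?D")
    case True
    then have "((\<lambda>u. (f (x + u) - f x) / u) \<longlongrightarrow> deriv f x) (at 0)"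
      by (simp add: DERIV_deriv_iff_field_differentiable flip: DERIV_def)
    moreover have "filterlim (\<lambda>k. 1 / real (Suc k)) (at 0) sequentially"
      using LIMSEQ_Suc[OF lim_1_over_n] by (auto simp: filterlim_at)
    ultimately show ?thesis
      using True by (auto simp: q_def dest: filterlim_compose)
  next
    case False
    then have "deriv f x = (SOME D. False)"
      by (simp add: deriv_def field_differentiable_def)
    with False show ?thesis
      by (simp add: q_def)
  qed
  ultimately show ?thesis
    by (rule borel_measurable_LIMSEQ_metric)
qed


subsection \<open>The Cameron--Martin space\<close>

text \<open>Sums and multiples of paths stay folded, so that rules about their derivatives and inner
  products still match.\<close>

declare plus_bcontfun.rep_eq [simp del] scaleR_bcontfun.rep_eq [simp del]

lemma borel_measurable_deriv_path [measurable]: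
  fixes h :: path
  shows "deriv h \<in> borel_measurable borel"
  by (intro borel_measurable_deriv continuous_on_apply_bcontfun continuous_on_id)

section \<open>Linear structure of the Cameron-Martin space\<close>

lemma absolutely_continuous_01_add:
  assumes "absolutely_continuous_01 f" and "absolutely_continuous_01 g"
  shows "absolutely_continuous_01 (\<lambda>t. f t + g t)"
  unfolding absolutely_continuous_01_def
proof (intro allI impI)
  fix \<epsilon> :: real
  assume "\<epsilon> > 0"
  let ?small = "\<lambda>h \<delta> \<epsilon>. \<forall>n (a :: nat \<Rightarrow> real) b.
        (\<forall>i<n. 0 \<le> a i \<and> a i \<le> b i \<and> b i \<le> 1) \<and>
        (\<forall>i<n. \<forall>j<n. i \<noteq> j \<longrightarrow> {a i<..<b i} \<inter> {a j<..<b j} = {}) \<and>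
        (\<Sum>i<n. b i - a i) < \<delta>
        \<longrightarrow> (\<Sum>i<n. \<bar>h (b i) - h (a i)\<bar>) < \<epsilon>"
  have "\<epsilon> / 2 > 0"
    using \<open>\<epsilon> > 0\<close> by simp
  note half = this
  obtain d where d: "d > 0" "?small f d (\<epsilon> / 2)"
    by (use assms(1)[unfolded absolutely_continuous_01_def, THEN spec, THEN mp, OF half]
        in \<open>elim exE conjE\<close>) (rule that)
  obtain d' where d': "d' > 0" "?small g d' (\<epsilon> / 2)"
    by (use assms(2)[unfolded absolutely_continuous_01_def, THEN spec, THEN mp, OF half]
        in \<open>elim exE conjE\<close>) (rule that)
  show "\<exists>\<delta>>0. ?small (\<lambda>t. f t + g t) \<delta> \<epsilon>"
  proof (intro exI[of _ "min d d'"] conjI allI impI)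
    fix n :: nat and a b :: "nat \<Rightarrow> real"
    assume ab: "(\<forall>i<n. 0 \<le> a i \<and> a i \<le> b i \<and> b i \<le> 1) \<and>
        (\<forall>i<n. \<forall>j<n. i \<noteq> j \<longrightarrow> {a i<..<b i} \<inter> {a j<..<b j} = {}) \<and>
        (\<Sum>i<n. b i - a i) < min d d'"
    have "(\<Sum>i<n. \<bar>f (b i) + g (b i) - (f (a i) + g (a i))\<bar>)
        \<le> (\<Sum>i<n. \<bar>f (b i) - f (a i)\<bar> + \<bar>g (b i) - g (a i)\<bar>)"
      by (intro sum_mono) linarith
    also have "\<dots> < \<epsilon>"
      using d(2)[THEN spec, THEN spec, THEN spec, THEN mp, of n a b]
        d'(2)[THEN spec, THEN spec, THEN spec, THEN mp, of n a b] ab by (simp add: sum.distrib)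
    finally show "(\<Sum>i<n. \<bar>f (b i) + g (b i) - (f (a i) + g (a i))\<bar>) < \<epsilon>" .
  qed (use d(1) d'(1) in auto)
qed

lemma absolutely_continuous_01_cmult:
  assumes "absolutely_continuous_01 f"
  shows "absolutely_continuous_01 (\<lambda>t. c * f t)"
  unfolding absolutely_continuous_01_def
proof (intro allI impI)
  fix \<epsilon> :: real
  assume "\<epsilon> > 0"
  let ?small = "\<lambda>h \<delta> \<epsilon>. \<forall>n (a :: nat \<Rightarrow> real) b.
        (\<forall>i<n. 0 \<le> a i \<and> a i \<le> b i \<and> b i \<le> 1) \<and>
        (\<forall>i<n. \<forall>j<n. i \<noteq> j \<longrightarrow> {a i<..<b i} \<inter> {a j<..<b j} = {}) \<and>
        (\<Sum>i<n. b i - a i) < \<delta>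
        \<longrightarrow> (\<Sum>i<n. \<bar>h (b i) - h (a i)\<bar>) < \<epsilon>"
  \<comment> \<open>The added \<open>1\<close> covers \<open>c = 0\<close>.\<close>
  have "\<epsilon> / (\<bar>c\<bar> + 1) > 0"
    using \<open>\<epsilon> > 0\<close> by simp
  note pos = this
  obtain d where d: "d > 0" "?small f d (\<epsilon> / (\<bar>c\<bar> + 1))"
    by (use assms[unfolded absolutely_continuous_01_def, THEN spec, THEN mp, OF pos]
        in \<open>elim exE conjE\<close>) (rule that)
  show "\<exists>\<delta>>0. ?small (\<lambda>t. c * f t) \<delta> \<epsilon>"
  proof (intro exI[of _ d] conjI allI impI)
    fix n :: nat and a b :: "nat \<Rightarrow> real"
    let ?s = "\<Sum>i<n. \<bar>f (b i) - f (a i)\<bar>"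
    assume ab: "(\<forall>i<n. 0 \<le> a i \<and> a i \<le> b i \<and> b i \<le> 1) \<and>
        (\<forall>i<n. \<forall>j<n. i \<noteq> j \<longrightarrow> {a i<..<b i} \<inter> {a j<..<b j} = {}) \<and>
        (\<Sum>i<n. b i - a i) < d"
    have "(\<Sum>i<n. \<bar>c * f (b i) - c * f (a i)\<bar>) = \<bar>c\<bar> * ?s"
      by (simp add: sum_distrib_left abs_mult flip: right_diff_distrib)
    also have "\<dots> \<le> (\<bar>c\<bar> + 1) * ?s"
      by (intro mult_right_mono sum_nonneg) auto
    also have "\<dots> < \<epsilon>"
      using d(2)[THEN spec, THEN spec, THEN spec, THEN mp, OF ab] by (simp add: field_simps)
    finally show "(\<Sum>i<n. \<bar>c * f (b i) - c * f (a i)\<bar>) < \<epsilon>" .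
  qed (use d(1) in auto)
qed

lemma deriv_path_add:
  fixes h k :: path
  assumes "(h :: real \<Rightarrow> real) differentiable (at t)" and "(k :: real \<Rightarrow> real) differentiable (at t)"
  shows "((h + k :: path) :: real \<Rightarrow> real) differentiable (at t)"
    and "deriv (h + k :: path) t = deriv h t + deriv k t"
proof -
  have "(h has_real_derivative deriv h t) (at t)" "(k has_real_derivative deriv k t) (at t)"
    using assms by (simp_all add: DERIV_deriv_iff_real_differentiable)
  then have "((h + k :: path) has_real_derivative deriv h t + deriv k t) (at t)"
    by (simp add: plus_bcontfun.rep_eq DERIV_add)
  then show "((h + k :: path) :: real \<Rightarrow> real) differentiable (at t)"
      "deriv (h + k :: path) t = deriv h t + deriv k t"
    by (auto simp: DERIV_imp_deriv real_differentiable_def)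
qed

lemma deriv_path_scaleR:
  fixes h :: path
  assumes "(h :: real \<Rightarrow> real) differentiable (at t)"
  shows "((c *\<^sub>R h :: path) :: real \<Rightarrow> real) differentiable (at t)"
    and "deriv (c *\<^sub>R h :: path) t = c * deriv h t"
proof -
  have "(h has_real_derivative deriv h t) (at t)"
    using assms by (simp add: DERIV_deriv_iff_real_differentiable)
  then have "((c *\<^sub>R h :: path) has_real_derivative c * deriv h t) (at t)"
    by (simp add: scaleR_bcontfun.rep_eq DERIV_cmult)
  then show "((c *\<^sub>R h :: path) :: real \<Rightarrow> real) differentiable (at t)"
      "deriv (c *\<^sub>R h :: path) t = c * deriv h t"
    by (auto simp: DERIV_imp_deriv real_differentiable_def)
qed

lemma cameron_martin_differentiable:
  assumes "h \<in> cameron_martin"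
  shows "AE t in lborel. t \<in> {0..1} \<longrightarrow> (h :: real \<Rightarrow> real) differentiable (at t)"
  using assms by (simp add: cameron_martin_def)

text \<open>Domination by the sum of the squares, from
  \<open>2 * \<bar>x * y\<bar> \<le> x\<^sup>2 + y\<^sup>2\<close>.\<close>

lemma cameron_martin_integrable_product:
  assumes "h \<in> cameron_martin" and "k \<in> cameron_martin"
  shows "set_integrable lborel {0..1} (\<lambda>t. deriv h t * deriv k t)"
proof -
  have "set_integrable lborel {0..1} (\<lambda>t. (deriv h t)\<^sup>2 + (deriv k t)\<^sup>2)"
    using assms by (intro set_integral_add) (simp_all add: cameron_martin_def)
  then show ?thesis
  proof (rule set_integrable_bound)
    have "\<bar>x * y\<bar> \<le> x\<^sup>2 + y\<^sup>2" for x y :: real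
    proof -
      have "2 * \<bar>x * y\<bar> \<le> x\<^sup>2 + y\<^sup>2"
        using sum_squares_bound[of "\<bar>x\<bar>" "\<bar>y\<bar>"] by (simp add: abs_mult)
      then show ?thesis by linarith
    qed
    then show "AE t in lborel. t \<in> {0..1} \<longrightarrow>
        norm (deriv h t * deriv k t) \<le> norm ((deriv h t)\<^sup>2 + (deriv k t)\<^sup>2)"
      by simp
  qed (simp add: set_borel_measurable_def)
qed

lemma cameron_martin_add:
  assumes h: "h \<in> cameron_martin" and k: "k \<in> cameron_martin"
  shows "h + k \<in> cameron_martin"
proof -
  have "set_integrable lborel {0..1}
      (\<lambda>t. (deriv h t)\<^sup>2 + (deriv k t)\<^sup>2 + 2 * (deriv h t * deriv k t))"
    using h k cameron_martin_integrable_product[OF h k]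
    by (intro set_integral_add set_integrable_mult_right) (simp_all add: cameron_martin_def)
  \<comment> \<open>Additivity of \<open>deriv\<close> is available where both paths are
    differentiable, that is, almost everywhere; integrability is transferred along this almost sure
    equality.\<close>
  moreover have "AE t in lborel. t \<in> {0..1} \<longrightarrow>
      (deriv h t)\<^sup>2 + (deriv k t)\<^sup>2 + 2 * (deriv h t * deriv k t) = (deriv (h + k :: path) t)\<^sup>2"
    using cameron_martin_differentiable[OF h] cameron_martin_differentiable[OF k]
    by eventually_elim (auto simp: deriv_path_add power2_eq_square algebra_simps)
  ultimately have "set_integrable lborel {0..1} (\<lambda>t. (deriv (h + k :: path) t)\<^sup>2)"
    by (subst (asm) set_integrable_cong_AE) (auto simp: set_borel_measurable_def)
  moreover have "AE t in lborel. t \<in> {0..1} \<longrightarrow> ((h + k :: path) :: real \<Rightarrow> real) differentiable (at t)"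
    using cameron_martin_differentiable[OF h] cameron_martin_differentiable[OF k]
    by eventually_elim (auto intro: deriv_path_add)
  moreover have "absolutely_continuous_01 (h + k :: path)"
    using h k absolutely_continuous_01_add[of h k]
    by (simp add: cameron_martin_def plus_bcontfun.rep_eq)
  moreover have "h + k \<in> wiener_paths"
    using h k by (simp add: cameron_martin_def wiener_paths_def plus_bcontfun.rep_eq)
  ultimately show ?thesis
    by (simp add: cameron_martin_def set_borel_measurable_def)
qed

lemma cameron_martin_scaleR:
  assumes h: "h \<in> cameron_martin"
  shows "c *\<^sub>R h \<in> cameron_martin"
proof -
  have "set_integrable lborel {0..1} (\<lambda>t. c\<^sup>2 * (deriv h t)\<^sup>2)"
    using h by (intro set_integrable_mult_right) (simp add: cameron_martin_def)
  moreover have "AE t in lborel. t \<in> {0..1} \<longrightarrow>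
      c\<^sup>2 * (deriv h t)\<^sup>2 = (deriv (c *\<^sub>R h :: path) t)\<^sup>2"
    using cameron_martin_differentiable[OF h]
    by eventually_elim (auto simp: deriv_path_scaleR power_mult_distrib)
  ultimately have "set_integrable lborel {0..1} (\<lambda>t. (deriv (c *\<^sub>R h :: path) t)\<^sup>2)"
    by (subst (asm) set_integrable_cong_AE) (auto simp: set_borel_measurable_def)
  moreover have "AE t in lborel. t \<in> {0..1} \<longrightarrow> ((c *\<^sub>R h :: path) :: real \<Rightarrow> real) differentiable (at t)"
    using cameron_martin_differentiable[OF h] by eventually_elim (auto intro: deriv_path_scaleR)
  moreover have "absolutely_continuous_01 (c *\<^sub>R h :: path)"
    using h absolutely_continuous_01_cmult[of h c]
    by (simp add: cameron_martin_def scaleR_bcontfun.rep_eq)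
  moreover have "c *\<^sub>R h \<in> wiener_paths"
    using h by (simp add: cameron_martin_def wiener_paths_def scaleR_bcontfun.rep_eq)
  ultimately show ?thesis
    by (simp add: cameron_martin_def set_borel_measurable_def)
qed

lemma cameron_martin_zero: "0 \<in> cameron_martin"
  by (auto simp: cameron_martin_def wiener_paths_def absolutely_continuous_01_def
      zero_bcontfun.rep_eq set_borel_measurable_def set_integrable_def intro: exI[of _ 1])

lemma subspace_cameron_martin: "subspace cameron_martin"
  by (simp add: subspace_def cameron_martin_add cameron_martin_scaleR cameron_martin_zero)

section \<open>The inner product and Parseval's identity\<close>

lemma cm_inner_commute: "cm_inner h k = cm_inner k h"
  by (simp add: cm_inner_def mult.commute)

lemma cm_inner_self_nonneg: "cm_inner h h \<ge> 0"
  unfolding cm_inner_def set_lebesgue_integral_def by (intro integral_nonneg_AE) auto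

lemma cm_inner_add_right:
  assumes h: "h \<in> cameron_martin" and k: "k \<in> cameron_martin" and l: "l \<in> cameron_martin"
  shows "cm_inner h (k + l) = cm_inner h k + cm_inner h l"
proof -
  have "cm_inner h (k + l) = (LINT t:{0..1}|lborel. deriv h t * deriv k t + deriv h t * deriv l t)"
    unfolding cm_inner_def
  proof (rule set_lebesgue_integral_cong_AE)
    show "AE t\<in>{0..1} in lborel.
        deriv h t * deriv (k + l :: path) t = deriv h t * deriv k t + deriv h t * deriv l t"
      using cameron_martin_differentiable[OF k] cameron_martin_differentiable[OF l]
      by eventually_elim (auto simp: deriv_path_add algebra_simps)
  qed auto
  then show ?thesis
    using h k l by (simp add: cm_inner_def set_integral_add cameron_martin_integrable_product)
qed

lemma cm_inner_scaleR_right: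
  assumes k: "k \<in> cameron_martin"
  shows "cm_inner h (c *\<^sub>R k) = c * cm_inner h k"
proof -
  have "cm_inner h (c *\<^sub>R k) = (LINT t:{0..1}|lborel. c * (deriv h t * deriv k t))"
    unfolding cm_inner_def
  proof (rule set_lebesgue_integral_cong_AE)
    show "AE t\<in>{0..1} in lborel. deriv h t * deriv (c *\<^sub>R k :: path) t = c * (deriv h t * deriv k t)"
      using cameron_martin_differentiable[OF k]
      by eventually_elim (auto simp: deriv_path_scaleR)
  qed auto
  then show ?thesis
    by (simp add: cm_inner_def)
qed

lemma cm_inner_diff_right:
  assumes "h \<in> cameron_martin" and "k \<in> cameron_martin" and "l \<in> cameron_martin"
  shows "cm_inner h (k - l) = cm_inner h k - cm_inner h l"
  using cm_inner_add_right[OF assms(1,2) cameron_martin_scaleR[OF assms(3)], of "-1"]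
    cm_inner_scaleR_right[OF assms(3), of h "-1"] by simp

lemma cm_inner_add_left:
  assumes "h \<in> cameron_martin" and "k \<in> cameron_martin" and "l \<in> cameron_martin"
  shows "cm_inner (h + k) l = cm_inner h l + cm_inner k l"
  using cm_inner_add_right[of l h k] assms by (simp only: cm_inner_commute[of l])

lemma cm_inner_diff_left:
  assumes "h \<in> cameron_martin" and "k \<in> cameron_martin" and "l \<in> cameron_martin"
  shows "cm_inner (h - k) l = cm_inner h l - cm_inner k l"
  using cm_inner_diff_right[of l h k] assms by (simp only: cm_inner_commute[of l])

lemma cm_inner_sum_right:
  assumes "h \<in> cameron_martin" and "\<And>i. k i \<in> cameron_martin"
  shows "cm_inner h (\<Sum>i<(n :: nat). c i *\<^sub>R k i) = (\<Sum>i<n. c i * cm_inner h (k i))"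
proof (induction n)
  case 0
  show ?case
    using cm_inner_scaleR_right[OF cameron_martin_zero, of h 0] by simp
next
  case (Suc n)
  have "(\<Sum>i<n. c i *\<^sub>R k i) \<in> cameron_martin"
    using assms by (intro subspace_sum[OF subspace_cameron_martin] cameron_martin_scaleR)
  with Suc assms show ?case
    by (simp add: cm_inner_add_right cm_inner_scaleR_right cameron_martin_scaleR)
qed

text \<open>Expand by bilinearity and orthonormality, then complete the square in each
  \<open>c i\<close>. The Fourier coefficients make the last sum vanish and give Bessel's
  inequality; for any other \<open>c\<close> the remainder bounds the Bessel defect from
  above.\<close>

lemma cm_inner_remainder:
  assumes e: "complete_orthonormal e" and h: "h \<in> cameron_martin"
    and r: "r = h - (\<Sum>i<n. c i *\<^sub>R e i)"
  shows "cm_inner r r =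
    cm_inner h h - (\<Sum>i<n. (cm_inner h (e i))\<^sup>2) + (\<Sum>i<n. (c i - cm_inner h (e i))\<^sup>2)"
proof -
  define s where "s = (\<Sum>i<n. c i *\<^sub>R e i)"
  have ecm: "e i \<in> cameron_martin" for i
    using e by (auto simp: complete_orthonormal_def)
  have s: "s \<in> cameron_martin"
    unfolding s_def by (intro subspace_sum[OF subspace_cameron_martin] cameron_martin_scaleR ecm)
  have r': "r \<in> cameron_martin"
    unfolding r s_def[symmetric] by (rule subspace_diff[OF subspace_cameron_martin h s])
  have hs: "cm_inner h s = (\<Sum>i<n. c i * cm_inner h (e i))"
    unfolding s_def by (rule cm_inner_sum_right[OF h ecm])
  have es: "cm_inner (e i) s = c i" if "i < n" for i
  proof -
    have "cm_inner (e i) s = (\<Sum>j<n. c j * (if i = j then 1 else 0))"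
      unfolding s_def cm_inner_sum_right[OF ecm ecm]
      using e by (simp add: complete_orthonormal_def)
    with that show ?thesis
      by (simp add: if_distrib cong: if_cong)
  qed
  have "cm_inner s s = (\<Sum>i<n. c i * cm_inner s (e i))"
    by (subst (2) s_def) (rule cm_inner_sum_right[OF s ecm])
  then have ss: "cm_inner s s = (\<Sum>i<n. (c i)\<^sup>2)"
    by (simp add: cm_inner_commute[of s "e _"] es power2_eq_square)
  have "cm_inner r r = cm_inner h h - 2 * cm_inner h s + cm_inner s s"
    using h s r' unfolding r s_def[symmetric]
    by (simp add: cm_inner_diff_left cm_inner_diff_right cm_inner_commute[of s h])
  then show ?thesis
    by (simp add: hs ss power2_diff sum.distrib sum_subtractf sum_distrib_left algebra_simps)
qed

text \<open>The partial sums increase and are bounded by Bessel's inequality. Completeness provides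
  some \<open>n\<close> and \<open>c\<close> with remainder of norm below
  \<open>sqrt \<epsilon>\<close>, so the defect at \<open>n\<close> is below
  \<open>\<epsilon>\<close>, and by monotonicity at every later index too. Nonnegative terms turn
  the convergent series into an unconditional sum.\<close>

lemma parseval_self:
  assumes e: "complete_orthonormal e" and h: "h \<in> cameron_martin"
  shows "((\<lambda>i. (cm_inner h (e i))\<^sup>2) has_sum cm_inner h h) UNIV"
proof (rule sums_nonneg_imp_has_sum)
  let ?S = "\<lambda>n. \<Sum>i<n. (cm_inner h (e i))\<^sup>2"
  have bessel: "?S n \<le> cm_inner h h" for n
    using cm_inner_remainder[OF e h refl, of "\<lambda>i. cm_inner h (e i)" n]
      cm_inner_self_nonneg[of "h - (\<Sum>i<n. cm_inner h (e i) *\<^sub>R e i)"] by simp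
  have "?S \<longlonglongrightarrow> cm_inner h h"
  proof (rule LIMSEQ_I)
    fix \<epsilon> :: real
    assume "\<epsilon> > 0"
    then have "sqrt \<epsilon> > 0" by simp
    then obtain n c where "sqrt (cm_inner (h - (\<Sum>i<n. c i *\<^sub>R e i)) (h - (\<Sum>i<n. c i *\<^sub>R e i))) < sqrt \<epsilon>"
      using e h unfolding complete_orthonormal_def Let_def by blast
    then have "cm_inner h h - ?S n < \<epsilon>"
      using cm_inner_remainder[OF e h refl, of c n]
        sum_nonneg[of "{..<n}" "\<lambda>i. (c i - cm_inner h (e i))\<^sup>2"] by simp
    moreover have "?S n \<le> ?S m" if "m \<ge> n" for m
      using that by (intro sum_mono2) auto
    ultimately have "norm (?S m - cm_inner h h) < \<epsilon>" if "m \<ge> n" for m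
      using that bessel[of m] by (smt (verit) real_norm_def)
    then show "\<exists>N. \<forall>m\<ge>N. norm (?S m - cm_inner h h) < \<epsilon>"
      by blast
  qed
  then show "(\<lambda>i. (cm_inner h (e i))\<^sup>2) sums cm_inner h h"
    by (simp add: sums_def)
qed simp

text \<open>Polarization: \<open>a * b = ((a + b)\<^sup>2 - (a - b)\<^sup>2) / 4\<close>, applied
  both to the coefficients and to the inner product.\<close>

lemma parseval:
  assumes e: "complete_orthonormal e" and h: "h \<in> cameron_martin" and k: "k \<in> cameron_martin"
  shows "((\<lambda>i. cm_inner h (e i) * cm_inner k (e i)) has_sum cm_inner h k) UNIV"
proof -
  have ecm: "e i \<in> cameron_martin" for i
    using e by (auto simp: complete_orthonormal_def)
  have add: "h + k \<in> cameron_martin" and diff: "h - k \<in> cameron_martin"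
    using h k by (auto intro: cameron_martin_add subspace_diff[OF subspace_cameron_martin])
  have "((\<lambda>i. ((cm_inner (h + k) (e i))\<^sup>2 - (cm_inner (h - k) (e i))\<^sup>2) * (1 / 4)) has_sum
      (cm_inner (h + k) (h + k) - cm_inner (h - k) (h - k)) * (1 / 4)) UNIV"
    by (intro has_sum_cmult_left has_sum_diff_real parseval_self e add diff)
  also have "(\<lambda>i. ((cm_inner (h + k) (e i))\<^sup>2 - (cm_inner (h - k) (e i))\<^sup>2) * (1 / 4)) =
      (\<lambda>i. cm_inner h (e i) * cm_inner k (e i))"
    by (simp add: cm_inner_add_left cm_inner_diff_left ecm h k power2_eq_square algebra_simps)
  also have "(cm_inner (h + k) (h + k) - cm_inner (h - k) (h - k)) * (1 / 4) = cm_inner h k"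
    by (simp add: cm_inner_add_left cm_inner_add_right cm_inner_diff_left cm_inner_diff_right
        add diff h k cm_inner_commute[of k h])
  finally show ?thesis .
qed


subsection \<open>Polynomial functionals along the Cameron--Martin space\<close>

text \<open>\<open>F\<close> is controlled only on the translate of \<open>cameron_martin\<close> by
  \<open>w\<close>. Since \<open>\<theta>\<close> and \<open>k\<close> lie in that subspace, the
  difference quotients never leave the translate.\<close>

lemma dir_deriv_polynomial_along:
  assumes p: "polynomial_fun n p" and h: "\<And>j. j < n \<Longrightarrow> h j \<in> cameron_martin"
    and F: "\<And>k. k \<in> cameron_martin \<Longrightarrow> F (w + k) = p (\<lambda>j. x j + cm_inner (h j) k)"
    and \<theta>: "\<theta> \<in> cameron_martin" and k: "k \<in> cameron_martin"
  shows "dir_deriv \<theta> F (w + k) =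
    dird (\<lambda>j. cm_inner (h j) \<theta>) p (\<lambda>j. x j + cm_inner (h j) k)"
proof -
  let ?y = "\<lambda>j. x j + cm_inner (h j) k" and ?v = "\<lambda>j. cm_inner (h j) \<theta>"
  have shift: "F (w + k + \<epsilon> *\<^sub>R \<theta>) = p (\<lambda>j. ?y j + \<epsilon> * ?v j)" for \<epsilon>
  proof -
    have "F (w + (k + \<epsilon> *\<^sub>R \<theta>)) = p (\<lambda>j. x j + cm_inner (h j) (k + \<epsilon> *\<^sub>R \<theta>))"
      by (intro F cameron_martin_add cameron_martin_scaleR k \<theta>)
    also have "\<dots> = p (\<lambda>j. ?y j + \<epsilon> * ?v j)"
      by (rule polynomial_fun_cong[OF p])
        (simp add: cm_inner_add_right cm_inner_scaleR_right cameron_martin_scaleR h k \<theta>)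
    finally show ?thesis
      by (simp add: add.assoc)
  qed
  have "((\<lambda>\<epsilon>. (F (w + k + \<epsilon> *\<^sub>R \<theta>) - F (w + k)) / \<epsilon>) \<longlongrightarrow> dird ?v p ?y) (at 0)"
    using has_real_derivative_dird[OF p, of ?y ?v] unfolding shift F[OF k] DERIV_def by simp
  then show ?thesis
    unfolding dir_deriv_def by (intro tendsto_Lim) simp_all
qed

lemma foldr_dir_deriv_polynomial_along:
  assumes p: "polynomial_fun n p" and h: "\<And>j. j < n \<Longrightarrow> h j \<in> cameron_martin"
    and F: "\<And>k. k \<in> cameron_martin \<Longrightarrow> F (w + k) = p (\<lambda>j. x j + cm_inner (h j) k)"
    and e: "\<And>i. e i \<in> cameron_martin" and k: "k \<in> cameron_martin"
  shows "foldr (\<lambda>i. dir_deriv (e i)) js F (w + k) =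
    foldr dird (map (\<lambda>i j. cm_inner (h j) (e i)) js) p (\<lambda>j. x j + cm_inner (h j) k)"
  using k
proof (induction js arbitrary: k)
  case (Cons i js)
  show ?case
    unfolding foldr.simps list.map o_apply
    \<comment> \<open>The induction hypothesis, for all \<open>k\<close>, is itself the
      representation that the next derivative requires of its argument.\<close>
    by (rule dir_deriv_polynomial_along[OF polynomial_fun_foldr_dird[OF p] h Cons.IH e Cons.prems])
qed (simp add: F)

text \<open>An instance of \<open>has_sum_iterated_dird\<close> in which Parseval's identity for
  \<open>Z w\<close> and \<open>h j\<close> supplies the assumption on the weighted
  directions.\<close>

lemma has_sum_D_term:
  assumes p: "polynomial_fun n p" and h: "\<And>j. j < n \<Longrightarrow> h j \<in> cameron_martin"
    and F: "\<And>k. k \<in> cameron_martin \<Longrightarrow> F (w + k) = p (\<lambda>j. x j + cm_inner (h j) k)"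
    and e: "complete_orthonormal e" and Z: "Z w \<in> cameron_martin"
  shows "(D_term e Z F w has_sum foldr dird (replicate N (\<lambda>j. cm_inner (h j) (Z w))) p x)
    {js. length js = N}"
proof -
  have ecm: "e i \<in> cameron_martin" for i
    using e by (auto simp: complete_orthonormal_def)
  let ?v = "\<lambda>i j. cm_inner (h j) (e i)"
  have "((\<lambda>i. cm_inner (Z w) (e i) * ?v i j) has_sum cm_inner (h j) (Z w)) UNIV" if "j < n" for j
    using parseval[OF e Z h[OF that]] by (simp add: cm_inner_commute[of "Z w" "h j"])
  note has_sum_iterated_dird[of n _ ?v, OF this p, where N = N and x = x]
  moreover have "foldr (\<lambda>i. dir_deriv (e i)) js F w = foldr dird (map ?v js) p x" for js
  proof -
    \<comment> \<open>Writing \<open>0\<close> as \<open>0 *\<^sub>R 0\<close> gives this for every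
      path \<open>k\<close>, hence also for the \<open>h j\<close> with \<open>j \<ge> n\<close>
      that occur in the argument function.\<close>
    have cm0: "cm_inner k 0 = 0" for k
      using cm_inner_scaleR_right[OF cameron_martin_zero, of k 0] by simp
    show ?thesis
      using foldr_dir_deriv_polynomial_along[of n p h F w x e 0 js, OF p h F ecm cameron_martin_zero]
      by (simp add: cm0)
  qed
  ultimately show ?thesis
    by (simp add: D_term_def[abs_def])
qed

text \<open>Summability and finiteness accompany the value because the infinite sums in
  \<open>D_power\<close> and \<open>exp_D\<close> return default values on divergent families; here
  they are genuine sums.\<close>

lemma exp_D_polynomial_along:
  assumes p: "polynomial_fun n p" and h: "\<And>j. j < n \<Longrightarrow> h j \<in> cameron_martin"
    and F: "\<And>k. k \<in> cameron_martin \<Longrightarrow> F (w + k) = p (\<lambda>j. x j + cm_inner (h j) k)"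
    and e: "complete_orthonormal e" and Z: "Z w \<in> cameron_martin"
  shows "D_term e Z F w summable_on {js. length js = N}"
    and "finite {N. D_power e Z N F w \<noteq> 0}"
    and "exp_D e Z F w = F (w + Z w)"
proof -
  let ?u = "\<lambda>j. cm_inner (h j) (Z w)"
  obtain r where r: "\<And>t. p (\<lambda>j. x j + t * ?u j) = poly r t"
    using polynomial_fun_line[OF p, of x ?u] by blast
  have sum: "(D_term e Z F w has_sum fact N * coeff r N) {js. length js = N}" for N
    using has_sum_D_term[of n p h F w x e Z N, OF p h F e Z] foldr_dird_replicate_coeff[OF r]
    by simp
  then show "D_term e Z F w summable_on {js. length js = N}"
    by (rule has_sum_imp_summable)
  have power: "D_power e Z N F w = fact N * coeff r N" for N
    unfolding D_power_def by (rule infsumI[OF sum])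
  show "finite {N. D_power e Z N F w \<noteq> 0}"
    by (rule finite_subset[of _ "{..degree r}"]) (auto simp: power intro: le_degree)
  \<comment> \<open>The factorials cancel, and what remains is the sum of the coefficients of
    \<open>r\<close>, its value at the parameter \<open>1\<close> of the shifted path.\<close>
  have "exp_D e Z F w = (\<Sum>N\<le>degree r. coeff r N)"
    unfolding exp_D_def power by (subst suminf_finite[of "{..degree r}"]) (auto simp: coeff_eq_0)
  also have "\<dots> = poly r 1"
    by (simp add: poly_altdef)
  also have "\<dots> = F (w + Z w)"
    using r[of 1] F[OF Z] by simp
  finally show "exp_D e Z F w = F (w + Z w)" .
qed

theorem proposition3p2:
  fixes \<gamma> :: "path measure"
    and I :: "path \<Rightarrow> path \<Rightarrow> real"
    and Z :: "path \<Rightarrow> path"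
    and e :: "nat \<Rightarrow> path"
    and f :: "path \<Rightarrow> real"
  assumes "wiener_measure \<gamma>"
    and "\<forall>h\<in>cameron_martin. wiener_integral \<gamma> h (I h)"
    and "shift_rule \<gamma> I"
    and "predictable_shift \<gamma> Z"
    and "complete_orthonormal e"
    and "f \<in> polynomial_functionals I"
  shows "AE w in \<gamma>.
           (\<forall>n. D_term e Z f w summable_on {js. length js = n}) \<and>
           finite {n. D_power e Z n f w \<noteq> 0} \<and>
           exp_D e Z f w = f (w + Z w)"
proof -
  obtain n p h where f: "f = (\<lambda>w. p (\<lambda>i. I (h i) w))" and "real_polynomial n p"
    and h: "\<And>i. i < n \<Longrightarrow> h i \<in> cameron_martin"
    using assms(6) by (auto simp: polynomial_functionals_def)
  then have p: "polynomial_fun n p"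
    by (simp add: real_polynomial_imp_polynomial_fun)
  \<comment> \<open>Only finitely many \<open>h j\<close> occur, so their exceptional sets combine
    to a null set. It is uniform in \<open>k\<close>, which later permits the path-dependent choice
    \<open>k = Z w\<close>.\<close>
  have "AE w in \<gamma>. \<forall>j\<in>{..<n}. \<forall>k\<in>cameron_martin. I (h j) (w + k) = I (h j) w + cm_inner (h j) k"
    using assms(3) h by (subst AE_ball_countable) (auto simp: shift_rule_def)
  moreover have "AE w in \<gamma>. Z w \<in> cameron_martin"
    using assms(4) by (simp add: predictable_shift_def)
  ultimately show ?thesis
  proof eventually_elim
    case (elim w)
    have F: "f (w + k) = p (\<lambda>j. I (h j) w + cm_inner (h j) k)" if "k \<in> cameron_martin" for k
      unfolding f using elim(1) that by (intro polynomial_fun_cong[OF p]) auto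
    show ?case
      using exp_D_polynomial_along[of n p h f w "\<lambda>j. I (h j) w" e Z, OF p h F assms(5) elim(2)] by blast
  qed
qed

end
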